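(* Let $G$ be a computable graph that is isomorphic to $K_\omega$, $\overline{K}_\omega$, or the random graph $\mathcal{R}$. Then for every computable partition of the vertex set $G=X_0\sqcup X_1$, the induced subgraph on $X_0$ or the induced subgraph on $X_1$ is computably isomorphic to $G$.
   Context: A graph is a set of vertices $V\subseteq\mathbb{N}$ with an irreflexive symmetric edge relation; it is computable if $V$ and the edge relation are computable. $K_\omega$ is the complete graph on $\mathbb{N}$, $\overline{K}_\omega$ the edgeless graph on $\mathbb{N}$, and $\mathcal{R}$ the (unique up to isomorphism) countable graph satisfying the extension axiom: for all disjoint finite vertex sets $A,B$ there is a vertex $x\notin A\cup B$ adjacent to every vertex of $A$ and to no vertex of $B$. *)

theory Defs
  imports Main
begin

section \<open>Computability on the natural numbers\<close>

text \<open>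
  Codes for partial recursive functions and their evaluation relation. A code carries no
  arity; on an argument list of unsuitable length it simply may have no value.
  The recursion argument of \<open>PrimRec\<close> and the search argument of \<open>Mu\<close> come first.
\<close>

datatype recf =
    Zero
  | Succ
  | Proj nat
  | Comp recf "recf list"
  | PrimRec recf recf
  | Mu recf

inductive computes :: "recf \<Rightarrow> nat list \<Rightarrow> nat \<Rightarrow> bool" where
  zero: "computes Zero xs 0"
| succ: "computes Succ [x] (Suc x)"
| proj: "i < length xs \<Longrightarrow> computes (Proj i) xs (xs ! i)"
| comp: "list_all2 (\<lambda>f y. computes f xs y) fs ys \<Longrightarrow> computes g ys z
          \<Longrightarrow> computes (Comp g fs) xs z"
| prim_0: "computes g xs y \<Longrightarrow> computes (PrimRec g h) (0 # xs) y"
| prim_Suc: "computes (PrimRec g h) (n # xs) r \<Longrightarrow> computes h (n # r # xs) y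
          \<Longrightarrow> computes (PrimRec g h) (Suc n # xs) y"
| mu: "computes f (n # xs) 0 \<Longrightarrow> (\<forall>m<n. \<exists>y. computes f (m # xs) (Suc y))
          \<Longrightarrow> computes (Mu f) xs n"

inductive_cases computes_ZeroE: "computes Zero xs y"
inductive_cases computes_SuccE: "computes Succ xs y"
inductive_cases computes_ProjE: "computes (Proj i) xs y"
inductive_cases computes_CompE: "computes (Comp g fs) xs y"
inductive_cases computes_PrimRec_0E: "computes (PrimRec g h) (0 # xs) y"
inductive_cases computes_PrimRec_SucE: "computes (PrimRec g h) (Suc n # xs) y"
inductive_cases computes_MuE: "computes (Mu f) xs y"

lemma computes_deterministic:
  "computes c xs y \<Longrightarrow> computes c xs z \<Longrightarrow> z = y"
proof (induction arbitrary: z rule: computes.induct)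
  case zero
  then show ?case by (rule computes_ZeroE)
next
  case succ
  then show ?case by (rule computes_SuccE) simp
next
  case proj
  from proj.prems show ?case by (rule computes_ProjE)
next
  case (comp xs fs ys g w)
  from comp.prems obtain ys' where
    ys': "list_all2 (\<lambda>f y. computes f xs y) fs ys'" "computes g ys' z"
    by (rule computes_CompE)
  have "ys' = ys"
    using comp.IH(1) ys'(1) by (simp add: list_all2_conv_all_nth list_eq_iff_nth_eq)
  with ys'(2) comp.IH(2) show ?case by blast
next
  case (prim_0 g xs y h)
  from prim_0.prems have "computes g xs z" by (rule computes_PrimRec_0E)
  with prim_0.IH show ?case by blast
next
  case (prim_Suc g h n xs r y)
  from prim_Suc.prems obtain r' where
    "computes (PrimRec g h) (n # xs) r'" "computes h (n # r' # xs) z"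
    by (rule computes_PrimRec_SucE)
  with prim_Suc.IH show ?case by blast
next
  case (mu f n xs)
  from mu.prems have z: "computes f (z # xs) 0" "\<forall>m<z. \<exists>y. computes f (m # xs) (Suc y)"
    by (blast elim: computes_MuE)+
  show ?case
  proof (rule linorder_cases[of z n])
    assume "z < n"
    with mu.IH(2) obtain y where "\<And>w. computes f (z # xs) w \<Longrightarrow> w = Suc y" by blast
    with z(1) show ?thesis by blast
  next
    assume "n < z"
    with z(2) obtain y where "computes f (n # xs) (Suc y)" by blast
    with mu.IH(1) show ?thesis by blast
  qed
qed

definition computable_set :: "nat set \<Rightarrow> bool" where
  "computable_set A \<longleftrightarrow> (\<exists>c. \<forall>x. computes c [x] (if x \<in> A then 1 else 0))"

definition computable_rel :: "nat rel \<Rightarrow> bool" where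
  "computable_rel E \<longleftrightarrow> (\<exists>c. \<forall>x y. computes c [x, y] (if (x, y) \<in> E then 1 else 0))"

text \<open>
  The behaviour of the code outside \<open>D\<close> is unconstrained. This is only used for
  computable \<open>D\<close>, where it makes no difference.
\<close>

definition computable_on :: "nat set \<Rightarrow> (nat \<Rightarrow> nat) \<Rightarrow> bool" where
  "computable_on D f \<longleftrightarrow> (\<exists>c. \<forall>x\<in>D. computes c [x] (f x))"


section \<open>Graphs on sets of natural numbers\<close>

record ngraph =
  verts :: "nat set"
  edges :: "nat rel"

definition is_graph :: "ngraph \<Rightarrow> bool" where
  "is_graph G \<longleftrightarrow> edges G \<subseteq> verts G \<times> verts G \<and> irrefl (edges G) \<and> sym (edges G)"

definition computable_graph :: "ngraph \<Rightarrow> bool" where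
  "computable_graph G \<longleftrightarrow>
     is_graph G \<and> computable_set (verts G) \<and> computable_rel (edges G)"

definition induced :: "ngraph \<Rightarrow> nat set \<Rightarrow> ngraph" where
  "induced G X = \<lparr>verts = X, edges = edges G \<inter> X \<times> X\<rparr>"

definition graph_iso :: "(nat \<Rightarrow> nat) \<Rightarrow> ngraph \<Rightarrow> ngraph \<Rightarrow> bool" where
  "graph_iso f G H \<longleftrightarrow>
     bij_betw f (verts G) (verts H) \<and>
     (\<forall>x\<in>verts G. \<forall>y\<in>verts G. (x, y) \<in> edges G \<longleftrightarrow> (f x, f y) \<in> edges H)"

definition isomorphic :: "ngraph \<Rightarrow> ngraph \<Rightarrow> bool" where
  "isomorphic G H \<longleftrightarrow> (\<exists>f. graph_iso f G H)"

definition computably_isomorphic :: "ngraph \<Rightarrow> ngraph \<Rightarrow> bool" where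
  "computably_isomorphic G H \<longleftrightarrow> (\<exists>f. computable_on (verts G) f \<and> graph_iso f G H)"

definition complete_omega :: ngraph where
  "complete_omega = \<lparr>verts = UNIV, edges = {(x, y). x \<noteq> y}\<rparr>"

definition edgeless_omega :: ngraph where
  "edgeless_omega = \<lparr>verts = UNIV, edges = {}\<rparr>"

definition extension_axiom :: "ngraph \<Rightarrow> bool" where
  "extension_axiom G \<longleftrightarrow>
     (\<forall>A B. finite A \<and> finite B \<and> A \<subseteq> verts G \<and> B \<subseteq> verts G \<and> A \<inter> B = {} \<longrightarrow>
        (\<exists>x\<in>verts G. x \<notin> A \<union> B \<and>
           (\<forall>a\<in>A. (x, a) \<in> edges G) \<and> (\<forall>b\<in>B. (x, b) \<notin> edges G)))"

text \<open>
  The random graph is determined only up to isomorphism, so it is given by a predicate;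
  being isomorphic to it means being isomorphic to some graph satisfying the predicate.
\<close>

definition random_graph :: "ngraph \<Rightarrow> bool" where
  "random_graph R \<longleftrightarrow> is_graph R \<and> extension_axiom R"


definition computable_partition :: "nat set \<Rightarrow> nat set \<Rightarrow> nat set \<Rightarrow> bool" where
  "computable_partition V X0 X1 \<longleftrightarrow>
     X0 \<union> X1 = V \<and> X0 \<inter> X1 = {} \<and> computable_set X0 \<and> computable_set X1"

end

theory Submission
  imports Defs "HOL-Library.Nat_Bijection"
begin

text \<open>
  If \<open>X\<^sub>0\<close> and \<open>X\<^sub>1\<close> both violated the extension axiom, the union of the two violating
  pairs of finite sets would violate it in \<open>G\<close>; and one part of an infinite set is infinite.
  So one part \<open>X\<close> is again of the same kind as \<open>G\<close>, and in all three cases any finite partial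
  isomorphism between \<open>G\<close> and \<open>G[X]\<close> extends to any further vertex on either side.
  The back-and-forth construction that always adds the least admissible pair is then
  computable.
\<close>

section \<open>Closure properties of total computable functions\<close>

text \<open>Arguments come as one list, so that terms in several variables can be proved computable
  by introduction rules that follow their syntax.\<close>

definition computable_fun :: "nat \<Rightarrow> (nat list \<Rightarrow> nat) \<Rightarrow> bool" where
  "computable_fun k f \<longleftrightarrow> (\<exists>c. \<forall>xs. length xs = k \<longrightarrow> computes c xs (f xs))"

definition decidable :: "nat \<Rightarrow> (nat list \<Rightarrow> bool) \<Rightarrow> bool" where
  "decidable k P \<longleftrightarrow> computable_fun k (\<lambda>xs. if P xs then 1 else 0)"

lemma computable_fun_cong:
  assumes "computable_fun k f" "\<And>xs. length xs = k \<Longrightarrow> f xs = g xs"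
  shows "computable_fun k g"
  using assms unfolding computable_fun_def by auto

lemma decidable_cong:
  assumes "decidable k P" "\<And>xs. length xs = k \<Longrightarrow> P xs \<longleftrightarrow> Q xs"
  shows "decidable k Q"
  using assms unfolding decidable_def by (auto elim!: computable_fun_cong)

lemma computable_fun_comp:
  assumes "computable_fun (length fs) g" "\<And>f. f \<in> set fs \<Longrightarrow> computable_fun k f"
  shows "computable_fun k (\<lambda>xs. g (map (\<lambda>f. f xs) fs))"
proof -
  obtain c where c: "\<And>xs. length xs = length fs \<Longrightarrow> computes c xs (g xs)"
    using assms(1) unfolding computable_fun_def by blast
  have "\<forall>f\<in>set fs. \<exists>d. \<forall>xs. length xs = k \<longrightarrow> computes d xs (f xs)"
    using assms(2) unfolding computable_fun_def by blast
  then obtain d where d: "\<And>f xs. f \<in> set fs \<Longrightarrow> length xs = k \<Longrightarrow> computes (d f) xs (f xs)"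
    by metis
  have "computes (Comp c (map d fs)) xs (g (map (\<lambda>f. f xs) fs))" if "length xs = k" for xs
  proof (rule computes.comp)
    show "list_all2 (\<lambda>f. computes f xs) (map d fs) (map (\<lambda>f. f xs) fs)"
      using that d by (auto simp: list_all2_conv_all_nth)
  qed (simp add: c)
  then show ?thesis unfolding computable_fun_def by blast
qed

lemma computable_fun_nth: "i < k \<Longrightarrow> computable_fun k (\<lambda>xs. xs ! i)"
  unfolding computable_fun_def by (blast intro: computes.proj)

lemma computable_fun_nth_drop:
  assumes "j + i < k" shows "computable_fun k (\<lambda>xs. drop j xs ! i)"
  by (rule computable_fun_cong[OF computable_fun_nth[OF assms]]) (use assms in auto)

text \<open>Weakening: recursion and search put their own variables in front of the parameters, and
  functions of the parameters alone have to be lifted past these.\<close>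

lemma computable_fun_drop:
  assumes "computable_fun k f" shows "computable_fun (j + k) (\<lambda>xs. f (drop j xs))"
proof -
  let ?fs = "map (\<lambda>i xs. xs ! (j + i)) [0..<k]"
  have "computable_fun (j + k) (\<lambda>xs. f (map (\<lambda>g. g xs) ?fs))"
    using assms by (intro computable_fun_comp) (auto intro: computable_fun_nth)
  then show ?thesis
    by (rule computable_fun_cong) (auto intro!: arg_cong[of _ _ f] nth_equalityI)
qed

lemma computable_fun_drop1:
  "computable_fun k f \<Longrightarrow> computable_fun (Suc k) (\<lambda>xs. f (drop 1 xs))"
  using computable_fun_drop[of k f 1] by simp

lemma computable_fun_drop2:
  "computable_fun k f \<Longrightarrow> computable_fun (Suc (Suc k)) (\<lambda>xs. f (drop 2 xs))"
  using computable_fun_drop[of k f 2] by simp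

lemma computable_fun_unary:
  assumes "\<And>x. computes c [x] (F x)" "computable_fun k f"
  shows "computable_fun k (\<lambda>xs. F (f xs))"
proof -
  have "computes c xs (F (xs ! 0))" if "length xs = 1" for xs
    using that assms(1)[of "xs ! 0"] by (cases xs) auto
  then have "computable_fun 1 (\<lambda>xs. F (xs ! 0))"
    unfolding computable_fun_def by blast
  then show ?thesis
    using computable_fun_comp[of "[f]" "\<lambda>xs. F (xs ! 0)" k] assms(2) by simp
qed

lemma computable_fun_binary:
  assumes "\<And>x y. computes c [x, y] (F x y)" "computable_fun k f" "computable_fun k g"
  shows "computable_fun k (\<lambda>xs. F (f xs) (g xs))"
proof -
  have "computes c xs (F (xs ! 0) (xs ! 1))" if "length xs = 2" for xs
    using that assms(1)[of "xs ! 0" "xs ! 1"] by (auto simp: length_Suc_conv numeral_2_eq_2)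
  then have "computable_fun 2 (\<lambda>xs. F (xs ! 0) (xs ! 1))"
    unfolding computable_fun_def by blast
  then show ?thesis
    using computable_fun_comp[of "[f, g]" "\<lambda>xs. F (xs ! 0) (xs ! 1)" k] assms(2,3)
    by (auto simp: numeral_2_eq_2)
qed

lemma computable_fun_Suc: "computable_fun k f \<Longrightarrow> computable_fun k (\<lambda>xs. Suc (f xs))"
  by (rule computable_fun_unary[OF computes.succ])

lemma computable_fun_const: "computable_fun k (\<lambda>xs. n)"
proof (induction n)
  case 0
  show ?case unfolding computable_fun_def by (blast intro: computes.zero)
next
  case (Suc n)
  then show ?case by (rule computable_fun_Suc)
qed

text \<open>The source of most closure facts below, which first rewrite a function as a
  \<open>rec_nat\<close>. In the step, position 0 holds the counter, position 1 the previous value,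
  and the parameters follow.\<close>

lemma computable_fun_rec_nat:
  assumes "computable_fun k g"
    and "computable_fun (Suc (Suc k)) (\<lambda>ys. H (ys ! 0) (ys ! 1) (drop 2 ys))"
    and "computable_fun k a"
  shows "computable_fun k (\<lambda>xs. rec_nat (g xs) (\<lambda>n r. H n r xs) (a xs))"
proof -
  obtain cg where cg: "\<And>xs. length xs = k \<Longrightarrow> computes cg xs (g xs)"
    using assms(1) unfolding computable_fun_def by blast
  obtain ch where ch: "\<And>ys. length ys = Suc (Suc k) \<Longrightarrow>
      computes ch ys (H (ys ! 0) (ys ! 1) (drop 2 ys))"
    using assms(2) unfolding computable_fun_def by blast
  let ?R = "\<lambda>n xs. rec_nat (g xs) (\<lambda>n r. H n r xs) n"
  have R: "computes (PrimRec cg ch) (n # xs) (?R n xs)" if "length xs = k" for n xs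
  proof (induction n)
    case 0
    show ?case using cg that by (auto intro: computes.prim_0)
  next
    case (Suc n)
    show ?case
      by (rule computes.prim_Suc[OF Suc]) (use ch[of "n # ?R n xs # xs"] that in simp)
  qed
  have "computable_fun (Suc k) (\<lambda>ys. ?R (hd ys) (tl ys))"
    unfolding computable_fun_def
    by (rule exI[of _ "PrimRec cg ch"]) (auto simp: length_Suc_conv R)
  \<comment> \<open>\<open>a\<close> supplies the recursion argument; the projections rebuild the
    parameter list \<open>xs\<close>.\<close>
  then have "computable_fun k (\<lambda>xs. (\<lambda>ys. ?R (hd ys) (tl ys))
      (map (\<lambda>f. f xs) (a # map (\<lambda>i xs. xs ! i) [0..<k])))"
    by (intro computable_fun_comp) (auto intro: computable_fun_nth assms(3))
  then show ?thesis
  proof (rule computable_fun_cong)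
    fix xs :: "nat list" assume "length xs = k"
    then have "map (\<lambda>f. f xs) (map (\<lambda>i xs. xs ! i) [0..<k]) = xs"
      by (auto intro!: nth_equalityI)
    then show "(\<lambda>ys. ?R (hd ys) (tl ys))
        (map (\<lambda>f. f xs) (a # map (\<lambda>i xs. xs ! i) [0..<k])) = ?R (a xs) xs" by simp
  qed
qed

text \<open>Recursion along the characteristic value: 0 leaves the base value \<open>g xs\<close>,
  and 1 makes a single step, which returns \<open>f xs\<close>.\<close>

lemma computable_fun_if:
  assumes "decidable k P" "computable_fun k f" "computable_fun k g"
  shows "computable_fun k (\<lambda>xs. if P xs then f xs else g xs)"
proof -
  have "computable_fun k (\<lambda>xs. rec_nat (g xs) (\<lambda>n r. f xs) (if P xs then 1 else 0))"
    using assms unfolding decidable_def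
    by (intro computable_fun_rec_nat computable_fun_drop2)
  then show ?thesis by (rule computable_fun_cong) simp
qed

section \<open>Arithmetic by primitive recursion\<close>

lemma computable_fun_add:
  assumes "computable_fun k f" "computable_fun k g"
  shows "computable_fun k (\<lambda>xs. f xs + g xs)"
proof -
  have rec: "m + n = rec_nat m (\<lambda>_ r. Suc r) n" for m n :: nat
    by (induction n) auto
  show ?thesis unfolding rec
    by (intro computable_fun_rec_nat computable_fun_Suc computable_fun_nth assms) simp
qed

lemma computable_fun_pred:
  assumes "computable_fun k f" shows "computable_fun k (\<lambda>xs. f xs - 1)"
proof -
  have rec: "m - 1 = rec_nat 0 (\<lambda>n _. n) m" for m :: nat
    by (cases m) auto
  show ?thesis unfolding rec
    by (intro computable_fun_rec_nat computable_fun_const computable_fun_nth assms) simp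
qed

lemma computable_fun_diff:
  assumes "computable_fun k f" "computable_fun k g"
  shows "computable_fun k (\<lambda>xs. f xs - g xs)"
proof -
  have rec: "rec_nat m (\<lambda>_ r. r - 1) n = m - n" for m n :: nat
    by (induction n) auto
  show ?thesis unfolding rec[symmetric, of "f _"]
    by (intro computable_fun_rec_nat computable_fun_pred computable_fun_nth assms) simp
qed

lemma computable_fun_triangle:
  assumes "computable_fun k f" shows "computable_fun k (\<lambda>xs. triangle (f xs))"
proof -
  have rec: "triangle n = rec_nat 0 (\<lambda>n r. r + Suc n) n" for n
    by (induction n) auto
  show ?thesis unfolding rec
    by (intro computable_fun_rec_nat computable_fun_add computable_fun_Suc computable_fun_const
        computable_fun_nth assms) simp_all
qed

section \<open>Decidable predicates\<close>

lemma decidable_eq_0: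
  assumes "computable_fun k f" shows "decidable k (\<lambda>xs. f xs = 0)"
proof -
  have rec: "(if m = 0 then 1 else 0) = rec_nat (1::nat) (\<lambda>_ _. 0) m" for m :: nat
    by (cases m) auto
  show ?thesis unfolding decidable_def rec
    by (intro computable_fun_rec_nat computable_fun_const assms)
qed

lemma decidable_conj:
  assumes "decidable k P" "decidable k Q" shows "decidable k (\<lambda>xs. P xs \<and> Q xs)"
proof -
  have "computable_fun k (\<lambda>xs. if P xs then (if Q xs then 1 else 0) else 0)"
    by (rule computable_fun_if[OF assms(1) assms(2)[unfolded decidable_def]
          computable_fun_const])
  then show ?thesis
    unfolding decidable_def by (rule computable_fun_cong) simp
qed

lemma decidable_not:
  assumes "decidable k P" shows "decidable k (\<lambda>xs. \<not> P xs)"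
proof -
  have "computable_fun k (\<lambda>xs. if P xs then 0 else 1)"
    by (intro computable_fun_if computable_fun_const assms)
  then show ?thesis
    unfolding decidable_def by (rule computable_fun_cong) simp
qed

lemma decidable_imp:
  assumes "decidable k P" "decidable k Q" shows "decidable k (\<lambda>xs. P xs \<longrightarrow> Q xs)"
  using decidable_not[OF decidable_conj[OF assms(1) decidable_not[OF assms(2)]]] by simp

lemma decidable_iff:
  assumes "decidable k P" "decidable k Q" shows "decidable k (\<lambda>xs. P xs \<longleftrightarrow> Q xs)"
  unfolding iff_conv_conj_imp by (intro decidable_conj decidable_imp assms)

lemma decidable_le:
  assumes "computable_fun k f" "computable_fun k g" shows "decidable k (\<lambda>xs. f xs \<le> g xs)"
  using decidable_eq_0[OF computable_fun_diff[OF assms]] by simp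

lemma decidable_eq:
  assumes "computable_fun k f" "computable_fun k g" shows "decidable k (\<lambda>xs. f xs = g xs)"
  unfolding order_eq_iff by (intro decidable_conj decidable_le assms)

text \<open>Recursion on the bound, accumulating the truth value. The accumulator occupies position
  1, so the parameters of \<open>P\<close> start at position 2.\<close>

lemma decidable_all_less:
  assumes "decidable (Suc (Suc k)) (\<lambda>ys. P (ys ! 0) (drop 2 ys))" "computable_fun k a"
  shows "decidable k (\<lambda>xs. \<forall>j<a xs. P j xs)"
proof -
  have rec: "(if \<forall>j<n. P j xs then 1 else 0) =
      rec_nat (1::nat) (\<lambda>j r. if P j xs then r else 0) n" for n xs
    by (induction n) (auto simp: less_Suc_eq)
  show ?thesis unfolding decidable_def rec
    by (intro computable_fun_rec_nat computable_fun_if computable_fun_const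
        computable_fun_nth assms) simp
qed

text \<open>A value is guaranteed only where a witness exists. The back-and-forth needs this partial
  form: an admissible pair need not exist for numbers \<open>w\<close> that code no genuine
  history.\<close>

lemma computes_LeastE:
  assumes "decidable (Suc k) (\<lambda>ys. P (ys ! 0) (drop 1 ys))"
  obtains c where "\<And>xs. length xs = k \<Longrightarrow> \<exists>n. P n xs \<Longrightarrow> computes c xs (LEAST n. P n xs)"
proof -
  \<comment> \<open>\<open>Mu\<close> searches for the value 0, so \<open>d\<close> decides the
    negation of \<open>P\<close>.\<close>
  obtain d where d: "\<And>ys. length ys = Suc k \<Longrightarrow>
      computes d ys (if \<not> P (ys ! 0) (drop 1 ys) then 1 else 0)"
    using decidable_not[OF assms] unfolding decidable_def computable_fun_def by blast
  have "computes (Mu d) xs (LEAST n. P n xs)" if "length xs = k" "\<exists>n. P n xs" for xs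
  proof (rule computes.mu)
    show "computes d ((LEAST n. P n xs) # xs) 0"
      using d[of "(LEAST n. P n xs) # xs"] that LeastI_ex[of "\<lambda>n. P n xs"] by simp
    show "\<forall>m<LEAST n. P n xs. \<exists>y. computes d (m # xs) (Suc y)"
    proof (intro allI impI)
      fix m assume "m < (LEAST n. P n xs)"
      then show "\<exists>y. computes d (m # xs) (Suc y)"
        using d[of "m # xs"] that not_less_Least[of m "\<lambda>n. P n xs"] by auto
    qed
  qed
  then show thesis by (rule that)
qed

lemma computable_fun_Least:
  assumes "decidable (Suc k) (\<lambda>ys. P (ys ! 0) (drop 1 ys))"
    and "\<And>xs. length xs = k \<Longrightarrow> \<exists>n. P n xs"
  shows "computable_fun k (\<lambda>xs. LEAST n. P n xs)"
  using computes_LeastE[OF assms(1)] assms(2) unfolding computable_fun_def by metis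

section \<open>Computable sets and relations as decidable predicates\<close>

lemma computable_setD:
  assumes "computable_set A" "computable_fun k f" shows "decidable k (\<lambda>xs. f xs \<in> A)"
proof -
  obtain c where "\<And>x. computes c [x] (if x \<in> A then 1 else 0)"
    using assms(1) unfolding computable_set_def by blast
  then show ?thesis
    unfolding decidable_def using assms(2) by (rule computable_fun_unary)
qed

lemma computable_relD:
  assumes "computable_rel E" "computable_fun k f" "computable_fun k g"
  shows "decidable k (\<lambda>xs. (f xs, g xs) \<in> E)"
proof -
  obtain c where "\<And>x y. computes c [x, y] (if (x, y) \<in> E then 1 else 0)"
    using assms(1) unfolding computable_rel_def by blast
  then show ?thesis
    unfolding decidable_def using assms(2,3) by (rule computable_fun_binary)
qed

lemma computable_relI:
  assumes "decidable 2 (\<lambda>xs. (xs ! 0, xs ! 1) \<in> E)" shows "computable_rel E"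
proof -
  obtain c where c: "\<And>xs. length xs = 2 \<Longrightarrow> computes c xs (if (xs ! 0, xs ! 1) \<in> E then 1 else 0)"
    using assms unfolding decidable_def computable_fun_def by blast
  then have "computes c [x, y] (if (x, y) \<in> E then 1 else 0)" for x y
    using c[of "[x, y]"] by simp
  then show ?thesis unfolding computable_rel_def by blast
qed


section \<open>Pairing\<close>

definition pfst :: "nat \<Rightarrow> nat" where "pfst z = fst (prod_decode z)"

definition psnd :: "nat \<Rightarrow> nat" where "psnd z = snd (prod_decode z)"

lemma pfst_encode [simp]: "pfst (prod_encode (m, n)) = m"
  and psnd_encode [simp]: "psnd (prod_encode (m, n)) = n"
  by (simp_all add: pfst_def psnd_def)

lemma triangle_mono: "m \<le> n \<Longrightarrow> triangle m \<le> triangle n"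
  by (rule lift_Suc_mono_le) auto

text \<open>\<open>prod_encode (m, n)\<close> is \<open>triangle (m + n) + m\<close>, so this is the
  index \<open>m + n\<close> of the antidiagonal of the pair. Finding it by search makes both
  projections computable.\<close>

definition diagonal :: "nat \<Rightarrow> nat" where "diagonal z = (LEAST t. Suc z \<le> triangle (Suc t))"

lemma diagonal_encode: "diagonal (prod_encode (m, n)) = m + n"
  unfolding diagonal_def
proof (rule Least_equality)
  show "Suc (prod_encode (m, n)) \<le> triangle (Suc (m + n))"
    by (simp add: prod_encode_def)
next
  fix t assume *: "Suc (prod_encode (m, n)) \<le> triangle (Suc t)"
  show "m + n \<le> t"
  proof (rule ccontr)
    assume "\<not> m + n \<le> t"
    then have "triangle (Suc t) \<le> triangle (m + n)" by (intro triangle_mono) simp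
    with * show False by (simp add: prod_encode_def)
  qed
qed

lemma pfst_eq: "pfst z = z - triangle (diagonal z)"
  and psnd_eq: "psnd z = diagonal z - pfst z"
proof -
  obtain m n where z: "z = prod_encode (m, n)"
    by (metis prod_decode_inverse surj_pair)
  show "pfst z = z - triangle (diagonal z)"
    unfolding z diagonal_encode pfst_encode by (simp add: prod_encode_def)
  show "psnd z = diagonal z - pfst z"
    unfolding z diagonal_encode by simp
qed

lemma computable_fun_diagonal:
  assumes "computable_fun k f" shows "computable_fun k (\<lambda>xs. diagonal (f xs))"
  unfolding diagonal_def
proof (rule computable_fun_Least)
  show "decidable (Suc k) (\<lambda>ys. Suc (f (drop 1 ys)) \<le> triangle (Suc (ys ! 0)))"
    by (intro decidable_le computable_fun_triangle computable_fun_Suc computable_fun_drop1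
        computable_fun_nth assms) simp
  show "\<exists>t. Suc (f xs) \<le> triangle (Suc t)" for xs
    by (rule exI[of _ "f xs"]) simp
qed

lemma computable_fun_pfst:
  assumes "computable_fun k f" shows "computable_fun k (\<lambda>xs. pfst (f xs))"
  unfolding pfst_eq
  by (intro computable_fun_diff computable_fun_triangle computable_fun_diagonal assms)

lemma computable_fun_psnd:
  assumes "computable_fun k f" shows "computable_fun k (\<lambda>xs. psnd (f xs))"
  unfolding psnd_eq
  by (intro computable_fun_diff computable_fun_diagonal computable_fun_pfst assms)

lemma computable_fun_prod_encode:
  assumes "computable_fun k f" "computable_fun k g"
  shows "computable_fun k (\<lambda>xs. prod_encode (f xs, g xs))"
  unfolding prod_encode_def
  by (simp, intro computable_fun_add computable_fun_triangle assms)

text \<open>Each \<open>psnd\<close> removes the latest entry of a coded history, so this gives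
  access to any earlier stage.\<close>

lemma computable_fun_funpow_psnd:
  assumes "computable_fun k f" "computable_fun k g"
  shows "computable_fun k (\<lambda>xs. (psnd ^^ g xs) (f xs))"
proof -
  have rec: "(psnd ^^ n) w = rec_nat w (\<lambda>_ r. psnd r) n" for n w
    by (induction n) auto
  show ?thesis unfolding rec
    by (intro computable_fun_rec_nat computable_fun_psnd computable_fun_nth assms) simp
qed

lemmas computable_intros =
  computable_fun_nth computable_fun_nth_drop computable_fun_const computable_fun_pfst
  computable_fun_psnd computable_fun_funpow_psnd
  decidable_conj decidable_imp decidable_not decidable_iff decidable_eq decidable_all_less


section \<open>Back and forth\<close>

text \<open>A set of pairwise compatible pairs is a partial isomorphism: the equality clause makes
  it single-valued and injective, the edge clause makes it preserve and reflect edges.\<close>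

definition compatible :: "ngraph \<Rightarrow> ngraph \<Rightarrow> nat \<times> nat \<Rightarrow> nat \<times> nat \<Rightarrow> bool" where
  "compatible G H p q \<longleftrightarrow> (fst p = fst q \<longleftrightarrow> snd p = snd q) \<and>
     ((fst p, fst q) \<in> edges G \<longleftrightarrow> (snd p, snd q) \<in> edges H)"

lemma compatible_sym:
  assumes "is_graph G" "is_graph H" "compatible G H p q" shows "compatible G H q p"
  using assms unfolding compatible_def is_graph_def sym_def by metis

lemma compatible_refl:
  assumes "is_graph G" "is_graph H" shows "compatible G H p p"
  using assms unfolding compatible_def is_graph_def irrefl_def by simp

lemma compatible_swap: "compatible H G (prod.swap p) (prod.swap q) \<longleftrightarrow> compatible G H p q"
  unfolding compatible_def by auto

text \<open>The forth half of back-and-forth; the back half is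
  \<open>extendable H G\<close>.\<close>

definition extendable :: "ngraph \<Rightarrow> ngraph \<Rightarrow> bool" where
  "extendable G H \<longleftrightarrow> (\<forall>P x. finite P \<and> P \<subseteq> verts G \<times> verts H \<and>
     (\<forall>p\<in>P. \<forall>q\<in>P. compatible G H p q) \<and> x \<in> verts G \<longrightarrow>
     (\<exists>y\<in>verts H. \<forall>p\<in>P. compatible G H p (x, y)))"

text \<open>
  \<open>w\<close> codes the pairs chosen at stages \<open>0, \<dots>, s - 1\<close> as nested pairs, latest first. The stages
  \<open>prod_encode (0, x)\<close> put \<open>x\<close> into the domain, all other stages \<open>prod_encode (i, y)\<close> put \<open>y\<close>
  into the range; if this is not a vertex, any compatible pair is admissible, possibly a
  repeated one.
\<close>

definition admissible :: "ngraph \<Rightarrow> ngraph \<Rightarrow> nat \<Rightarrow> nat \<Rightarrow> nat \<Rightarrow> bool" where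
  "admissible G H z s w \<longleftrightarrow> pfst z \<in> verts G \<and> psnd z \<in> verts H \<and>
     (pfst s = 0 \<longrightarrow> psnd s \<in> verts G \<longrightarrow> pfst z = psnd s) \<and>
     (\<not> pfst s = 0 \<longrightarrow> psnd s \<in> verts H \<longrightarrow> psnd z = psnd s) \<and>
     (\<forall>j<s. compatible G H (prod_decode (pfst ((psnd ^^ j) w))) (prod_decode z))"

lemma decidable_admissible:
  assumes "computable_graph G" "computable_graph H"
  shows "decidable 3 (\<lambda>xs. admissible G H (xs ! 0) (xs ! 1) (xs ! 2))"
proof -
  note * = assms[unfolded computable_graph_def]
  \<comment> \<open>Folding \<open>prod_decode\<close> back into \<open>pfst\<close> and
    \<open>psnd\<close> leaves atomic decidable conditions under a bounded quantifier.\<close>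
  show ?thesis
    unfolding admissible_def compatible_def pfst_def[symmetric] psnd_def[symmetric]
    by ((rule computable_intros computable_setD computable_relD *[THEN conjunct2, THEN conjunct1]
          *[THEN conjunct2, THEN conjunct2] | simp (no_asm))+)
qed

text \<open>One stage of the construction, with \<open>a\<close> and \<open>v\<close> standing for
  \<open>pfst s\<close> and \<open>psnd s\<close>.\<close>

lemma extension_step:
  assumes "extendable G H" "extendable H G" "verts G \<noteq> {}"
    and "finite P" "P \<subseteq> verts G \<times> verts H"
    and "\<And>p q. p \<in> P \<Longrightarrow> q \<in> P \<Longrightarrow> compatible G H p q"
  shows "\<exists>x\<in>verts G. \<exists>y\<in>verts H. (a = 0 \<longrightarrow> v \<in> verts G \<longrightarrow> x = v) \<and>
    (a \<noteq> (0::nat) \<longrightarrow> v \<in> verts H \<longrightarrow> y = v) \<and> (\<forall>p\<in>P. compatible G H p (x, y))"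
proof -
  have forward: "\<exists>y\<in>verts H. \<forall>p\<in>P. compatible G H p (x, y)" if "x \<in> verts G" for x
    using assms(1,4-6) that unfolding extendable_def by blast
  have backward: "\<exists>x\<in>verts G. \<forall>p\<in>P. compatible G H p (x, y)" if "y \<in> verts H" for y
  proof -
    \<comment> \<open>Going back is going forth from \<open>H\<close> to \<open>G\<close> with all
      pairs swapped.\<close>
    have "\<exists>x\<in>verts G. \<forall>p\<in>prod.swap ` P. compatible H G p (y, x)"
      by (rule assms(2)[unfolded extendable_def, rule_format])
        (use assms(4-6) that in \<open>auto simp: compatible_def\<close>)
    then show ?thesis
      using compatible_swap[of H G _ "(_, y)"] by simp
  qed
  \<comment> \<open>The default pair, for stages whose requested number \<open>v\<close> is not a
    vertex.\<close>
  obtain x0 y0 where any: "x0 \<in> verts G" "y0 \<in> verts H" "\<forall>p\<in>P. compatible G H p (x0, y0)"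
    using assms(3) forward by blast
  show ?thesis
  proof (cases "a = 0")
    case True
    obtain x y where "x \<in> verts G" "v \<in> verts G \<longrightarrow> x = v" "y \<in> verts H"
        "\<forall>p\<in>P. compatible G H p (x, y)"
      using any forward by (cases "v \<in> verts G") blast+
    with True show ?thesis by blast
  next
    case False
    obtain x y where "x \<in> verts G" "v \<in> verts H \<longrightarrow> y = v" "y \<in> verts H"
        "\<forall>p\<in>P. compatible G H p (x, y)"
      using any backward by (cases "v \<in> verts H") blast+
    with False show ?thesis by blast
  qed
qed

lemma computably_isomorphicI:
  assumes graphs: "computable_graph G" "computable_graph H"
    and ext: "extendable G H" "extendable H G" and ne: "verts G \<noteq> {}"
  shows "computably_isomorphic G H"
proof -
  have gr: "is_graph G" "is_graph H"
    using graphs unfolding computable_graph_def by auto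
  \<comment> \<open>The recursion sees only its last value, so this value is the whole history.
    Entries of the initial 0 are never read, because stage \<open>s\<close> inspects only the
    entries \<open>j < s\<close>.\<close>
  define hist where
    "hist = rec_nat 0 (\<lambda>s w. prod_encode (LEAST z. admissible G H z s w, w))"
  define z where "z s = pfst (hist (Suc s))" for s
  define p where "p s = prod_decode (z s)" for s
  have fst_p: "fst (p s) = pfst (z s)" and snd_p: "snd (p s) = psnd (z s)" for s
    by (simp_all add: p_def pfst_def psnd_def)
  have hist_Suc: "hist (Suc s) = prod_encode (LEAST z. admissible G H z s (hist s), hist s)" for s
    by (simp add: hist_def)
  have z_eq: "z s = (LEAST z. admissible G H z s (hist s))" for s
    by (simp add: z_def hist_Suc)
  have shift: "(psnd ^^ j) (hist (j + i)) = hist i" for i j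
  proof (induction j)
    case (Suc j)
    have "(psnd ^^ Suc j) (hist (Suc j + i)) = (psnd ^^ j) (psnd (hist (Suc (j + i))))"
      by (simp add: funpow_swap1)
    then show ?case using Suc by (simp add: hist_Suc)
  qed simp
  \<comment> \<open>The history is stored latest first, so entry \<open>j\<close> belongs to stage
    \<open>s - Suc j\<close>; this reversal permutes the stages below \<open>s\<close>.\<close>
  have entries: "(\<forall>j<s. Q (pfst ((psnd ^^ j) (hist s)))) \<longleftrightarrow> (\<forall>i<s. Q (z i))" for Q s
  proof -
    have "pfst ((psnd ^^ j) (hist s)) = z (s - Suc j)" if "j < s" for j
      using shift[of j "Suc (s - Suc j)"] that by (simp add: z_def)
    then have "(\<forall>j<s. Q (pfst ((psnd ^^ j) (hist s)))) \<longleftrightarrow> (\<forall>j<s. Q (z (s - Suc j)))"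
      by simp
    also have "\<dots> \<longleftrightarrow> (\<forall>i<s. Q (z i))"
    proof (intro iffI allI impI)
      fix i assume *: "\<forall>j<s. Q (z (s - Suc j))" "i < s"
      then have "s - Suc i < s" "s - Suc (s - Suc i) = i" by auto
      with *(1) show "Q (z i)" by metis
    qed auto
    finally show ?thesis .
  qed
  have adm_iff: "admissible G H u s (hist s) \<longleftrightarrow> pfst u \<in> verts G \<and> psnd u \<in> verts H \<and>
      (pfst s = 0 \<longrightarrow> psnd s \<in> verts G \<longrightarrow> pfst u = psnd s) \<and>
      (pfst s \<noteq> 0 \<longrightarrow> psnd s \<in> verts H \<longrightarrow> psnd u = psnd s) \<and>
      (\<forall>i<s. compatible G H (p i) (prod_decode u))" for u s
    unfolding admissible_def p_def
    using entries[of s "\<lambda>v. compatible G H (prod_decode v) (prod_decode u)"] by blast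
  \<comment> \<open>Admissibility of all earlier choices makes them a finite partial isomorphism, to
    which \<open>extension_step\<close> applies. Only then is the \<open>LEAST\<close> in
    \<open>z_eq\<close> known to be admissible.\<close>
  have ex_adm: "\<exists>u. admissible G H u s (hist s)"
    if IH: "\<And>i. i < s \<Longrightarrow> admissible G H (z i) i (hist i)" for s
  proof -
    have less: "compatible G H (p i) (p j)" if "i < j" "j < s" for i j
      using IH[of j] that unfolding adm_iff by (simp add: p_def)
    \<comment> \<open>Each stage checks only earlier ones; symmetry and reflexivity supply the other
      pairs.\<close>
    have comp: "compatible G H (p i) (p j)" if "i < s" "j < s" for i j
      using less[of i j] less[of j i] compatible_sym[OF gr] compatible_refl[OF gr] that
      by (metis linorder_neqE_nat)
    have "p i \<in> verts G \<times> verts H" if "i < s" for i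
      using IH[OF that] fst_p[of i] snd_p[of i] unfolding adm_iff by (metis mem_Times_iff)
    then have "\<exists>x\<in>verts G. \<exists>y\<in>verts H. (pfst s = 0 \<longrightarrow> psnd s \<in> verts G \<longrightarrow> x = psnd s) \<and>
        (pfst s \<noteq> 0 \<longrightarrow> psnd s \<in> verts H \<longrightarrow> y = psnd s) \<and>
        (\<forall>q\<in>p ` {..<s}. compatible G H q (x, y))"
      using comp by (intro extension_step ext ne) blast+
    then obtain x y where xy: "x \<in> verts G" "y \<in> verts H"
        "pfst s = 0 \<longrightarrow> psnd s \<in> verts G \<longrightarrow> x = psnd s"
        "pfst s \<noteq> 0 \<longrightarrow> psnd s \<in> verts H \<longrightarrow> y = psnd s"
        "\<forall>q\<in>p ` {..<s}. compatible G H q (x, y)"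
      by (elim bexE conjE) (rule that)
    have "admissible G H (prod_encode (x, y)) s (hist s)"
      unfolding adm_iff pfst_encode psnd_encode prod_encode_inverse
      by (intro conjI) (use xy in simp_all)
    then show ?thesis ..
  qed
  have adm: "admissible G H (z s) s (hist s)" for s
  proof (induction s rule: less_induct)
    case (less s)
    from ex_adm[OF this] show ?case unfolding z_eq by (rule LeastI_ex)
  qed
  have range: "fst (p s) \<in> verts G" "snd (p s) \<in> verts H" for s
    using adm[of s] unfolding adm_iff fst_p snd_p by auto
  have less: "compatible G H (p i) (p j)" if "i < j" for i j
    using adm[of j] that unfolding adm_iff by (simp add: p_def)
  have comp: "compatible G H (p i) (p j)" for i j
    using less[of i j] less[of j i] compatible_sym[OF gr] compatible_refl[OF gr]
    by (metis linorder_neqE_nat)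
  \<comment> \<open>The image of \<open>x\<close> is read off at the stage that forces
    \<open>x\<close> into the domain.\<close>
  define f where "f x = psnd (z (prod_encode (0, x)))" for x
  have dom: "fst (p (prod_encode (0, x))) = x" if "x \<in> verts G" for x
    using adm[of "prod_encode (0, x)"] that unfolding adm_iff fst_p by simp
  have f_p: "snd (p (prod_encode (0, x))) = f x" for x
    unfolding snd_p f_def ..
  have cod: "snd (p (prod_encode (1, y))) = y" if "y \<in> verts H" for y
    using adm[of "prod_encode (1, y)"] that unfolding adm_iff snd_p by simp
  have "graph_iso f G H"
    unfolding graph_iso_def bij_betw_def
  proof (intro conjI ballI inj_onI)
    fix x y assume xy: "x \<in> verts G" "y \<in> verts G"
    \<comment> \<open>Compatibility of the two stages defining \<open>f x\<close> and
      \<open>f y\<close> yields both edge preservation and injectivity.\<close>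
    note c = comp[of "prod_encode (0, x)" "prod_encode (0, y)", unfolded compatible_def f_p
        dom[OF xy(1)] dom[OF xy(2)]]
    show "(x, y) \<in> edges G \<longleftrightarrow> (f x, f y) \<in> edges H" using c by blast
    show "x = y" if "f x = f y" using c that by blast
  next
    show "f ` verts G = verts H"
    proof (intro equalityI subsetI)
      fix y assume y: "y \<in> verts H"
      \<comment> \<open>\<open>?x\<close> is the partner of \<open>y\<close> at the stage forcing
        \<open>y\<close> into the range. The stage for \<open>?x\<close> has the same first
        component, so by compatibility it also has second component \<open>y\<close>.\<close>
      let ?x = "fst (p (prod_encode (1, y)))"
      have "f ?x = y"
        using comp[of "prod_encode (1, y)" "prod_encode (0, ?x)"] dom[OF range(1)] cod[OF y]
        unfolding compatible_def f_p by metis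
      then show "y \<in> f ` verts G" using range(1) by (metis imageI)
    next
      fix y assume "y \<in> f ` verts G"
      then show "y \<in> verts H" using range(2) f_p by (metis imageE)
    qed
  qed
  moreover have "computable_on (verts G) f"
  proof -
    let ?P = "\<lambda>n xs. admissible G H n (xs ! 0) (xs ! 1)"
    have "decidable 3 (\<lambda>ys. ?P (ys ! 0) (drop 1 ys))"
      by (rule decidable_cong[OF decidable_admissible[OF graphs]])
        (auto simp: numeral_3_eq_3 numeral_2_eq_2 length_Suc_conv)
    then have "decidable (Suc 2) (\<lambda>ys. ?P (ys ! 0) (drop 1 ys))"
      by (simp only: eval_nat_numeral)
    then obtain c where c: "\<And>xs. length xs = 2 \<Longrightarrow> \<exists>n. ?P n xs \<Longrightarrow>
        computes c xs (LEAST n. ?P n xs)"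
      by (rule computes_LeastE) blast
    have "computable_fun 2 (\<lambda>xs. prod_encode (xs ! 0, xs ! 1))"
      by (intro computable_fun_prod_encode computable_intros) simp_all
    then obtain d where d: "\<And>xs. length xs = 2 \<Longrightarrow> computes d xs (prod_encode (xs ! 0, xs ! 1))"
      unfolding computable_fun_def by blast
    \<comment> \<open>\<open>c\<close> is guaranteed a value only on genuine histories, so
      \<open>computable_fun_rec_nat\<close>, which wants a total step, does not apply. The recursion
      is evaluated along the actual run instead, where \<open>adm\<close> provides the
      witnesses.\<close>
    have hist: "computes (PrimRec Zero (Comp d [c, Proj 1])) [s] (hist s)" for s
    proof (induction s)
      case 0
      show ?case by (simp add: hist_def computes.zero computes.prim_0)
    next
      case (Suc s)
      have "computes c [s, hist s] (z s)"
        using c[of "[s, hist s]"] adm[of s] unfolding z_eq by auto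
      moreover have "computes (Proj 1) [s, hist s] (hist s)"
        using computes.proj[of 1 "[s, hist s]"] by simp
      moreover have "computes d [z s, hist s] (hist (Suc s))"
        using d[of "[z s, hist s]"] by (simp add: hist_Suc z_eq)
      ultimately show ?case
        by (intro computes.prim_Suc[OF Suc] computes.comp) auto
    qed
    have "computable_fun 1 (\<lambda>xs. f (xs ! 0))"
      unfolding f_def z_def
      by (intro computable_fun_psnd computable_fun_pfst computable_fun_unary[OF hist]
          computable_fun_Suc computable_fun_prod_encode computable_intros) simp
    then obtain e where e: "\<And>xs. length xs = 1 \<Longrightarrow> computes e xs (f (xs ! 0))"
      unfolding computable_fun_def by blast
    have "computes e [x] (f x)" for x using e[of "[x]"] by simp
    then show ?thesis unfolding computable_on_def by blast
  qed
  ultimately show ?thesis unfolding computably_isomorphic_def by blast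
qed


section \<open>The three kinds of graphs\<close>

text \<open>If \<open>x\<close> is already in the domain of \<open>P\<close>, its partner there
  works again, since \<open>P\<close> is pairwise compatible.\<close>

lemma extendableI:
  assumes "\<And>P x. finite P \<Longrightarrow> P \<subseteq> verts G \<times> verts H \<Longrightarrow>
      (\<And>p q. p \<in> P \<Longrightarrow> q \<in> P \<Longrightarrow> compatible G H p q) \<Longrightarrow> x \<in> verts G \<Longrightarrow> x \<notin> fst ` P \<Longrightarrow>
      \<exists>y\<in>verts H. \<forall>p\<in>P. compatible G H p (x, y)"
  shows "extendable G H"
  unfolding extendable_def
proof (intro allI impI, elim conjE)
  fix P x
  assume P: "finite P" "P \<subseteq> verts G \<times> verts H" "\<forall>p\<in>P. \<forall>q\<in>P. compatible G H p q"
    and x: "x \<in> verts G"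
  show "\<exists>y\<in>verts H. \<forall>p\<in>P. compatible G H p (x, y)"
  proof (cases "x \<in> fst ` P")
    case True
    then show ?thesis using P by fastforce
  next
    case False
    then show ?thesis using assms P x by blast
  qed
qed

text \<open>\<open>b\<close> says whether the graphs are complete or edgeless. Either way equality
  determines the edges, so any vertex of \<open>H\<close> not yet used as a second component will
  do.\<close>

lemma extendable_uniform:
  assumes "infinite (verts H)"
    and "\<And>x y. x \<in> verts G \<Longrightarrow> y \<in> verts G \<Longrightarrow> (x, y) \<in> edges G \<longleftrightarrow> x \<noteq> y \<and> b"
    and "\<And>x y. x \<in> verts H \<Longrightarrow> y \<in> verts H \<Longrightarrow> (x, y) \<in> edges H \<longleftrightarrow> x \<noteq> y \<and> b"
  shows "extendable G H"
proof (rule extendableI)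
  fix P x
  assume P: "finite P" "P \<subseteq> verts G \<times> verts H" and x: "x \<in> verts G" "x \<notin> fst ` P"
  obtain y where y: "y \<in> verts H" "y \<notin> snd ` P"
    using assms(1) P(1) by (meson ex_new_if_finite finite_imageI finite_subset subsetI)
  have "compatible G H p (x, y)" if "p \<in> P" for p
  proof -
    have "fst p \<in> verts G" "snd p \<in> verts H" "fst p \<noteq> x" "snd p \<noteq> y"
      using that P(2) x(2) y(2) by auto
    then show ?thesis using assms(2,3) x(1) y(1) by (simp add: compatible_def)
  qed
  with y(1) show "\<exists>y\<in>verts H. \<forall>p\<in>P. compatible G H p (x, y)" by blast
qed

lemma extension_axiomD:
  assumes "extension_axiom G" "finite A" "finite B" "A \<subseteq> verts G" "B \<subseteq> verts G" "A \<inter> B = {}"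
  shows "\<exists>x\<in>verts G. x \<notin> A \<union> B \<and> (\<forall>a\<in>A. (x, a) \<in> edges G) \<and> (\<forall>b\<in>B. (x, b) \<notin> edges G)"
  using assms unfolding extension_axiom_def by blast

text \<open>The image of \<open>x\<close> must be adjacent to the partners of the neighbours of
  \<open>x\<close> and to no other partner; the extension axiom in \<open>H\<close> yields a fresh
  vertex of this kind.\<close>

lemma extendable_extension_axiom:
  assumes "is_graph G" "is_graph H" "extension_axiom H" shows "extendable G H"
proof (rule extendableI)
  fix P x
  assume P: "finite P" "P \<subseteq> verts G \<times> verts H"
      "\<And>p q. p \<in> P \<Longrightarrow> q \<in> P \<Longrightarrow> compatible G H p q"
    and x: "x \<in> verts G" "x \<notin> fst ` P"
  let ?A = "snd ` {p \<in> P. (x, fst p) \<in> edges G}"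
  let ?B = "snd ` {p \<in> P. (x, fst p) \<notin> edges G}"
  \<comment> \<open>Pairs of \<open>P\<close> with equal second components have equal first
    components, which cannot be both adjacent and non-adjacent to \<open>x\<close>.\<close>
  have "?A \<inter> ?B = {}"
    using P(3) unfolding compatible_def by auto metis
  then have "\<exists>y\<in>verts H. y \<notin> ?A \<union> ?B \<and> (\<forall>a\<in>?A. (y, a) \<in> edges H) \<and> (\<forall>b\<in>?B. (y, b) \<notin> edges H)"
    using assms(3) P(1,2) by (intro extension_axiomD) auto
  then obtain y where y: "y \<in> verts H" "y \<notin> ?A \<union> ?B"
      "\<forall>a\<in>?A. (y, a) \<in> edges H" "\<forall>b\<in>?B. (y, b) \<notin> edges H" by blast
  have "compatible G H p (x, y)" if "p \<in> P" for p
  proof -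
    have "(x, fst p) \<in> edges G \<longleftrightarrow> (y, snd p) \<in> edges H" "fst p \<noteq> x" "snd p \<noteq> y"
      using that x(2) y(2-4) by blast+
    then show ?thesis
      using assms(1,2) unfolding compatible_def is_graph_def by (auto dest: symD)
  qed
  with y(1) show "\<exists>y\<in>verts H. \<forall>p\<in>P. compatible G H p (x, y)" by blast
qed

section \<open>The extension axiom under isomorphism and partition\<close>

lemma extension_axiom_isomorphic:
  assumes "isomorphic G R" "extension_axiom R" shows "extension_axiom G"
  unfolding extension_axiom_def
proof (intro allI impI, elim conjE)
  fix A B
  assume A: "finite A" "A \<subseteq> verts G" and B: "finite B" "B \<subseteq> verts G" and "A \<inter> B = {}"
  obtain f where f: "bij_betw f (verts G) (verts R)"
      "\<And>x y. x \<in> verts G \<Longrightarrow> y \<in> verts G \<Longrightarrow> (x, y) \<in> edges G \<longleftrightarrow> (f x, f y) \<in> edges R"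
    using assms(1) unfolding isomorphic_def graph_iso_def by blast
  then have inj: "inj_on f (verts G)" and im: "f ` verts G = verts R"
    by (auto simp: bij_betw_def)
  have "f ` A \<inter> f ` B = {}"
    using \<open>A \<inter> B = {}\<close> A B inj by (metis image_empty inj_on_image_Int)
  then have "\<exists>x\<in>verts R. x \<notin> f ` A \<union> f ` B \<and> (\<forall>a\<in>f ` A. (x, a) \<in> edges R) \<and>
      (\<forall>b\<in>f ` B. (x, b) \<notin> edges R)"
    using assms(2) A B im by (intro extension_axiomD) blast+
  then obtain y where y: "y \<in> verts R" "y \<notin> f ` A \<union> f ` B"
      "\<forall>a\<in>f ` A. (y, a) \<in> edges R" "\<forall>b\<in>f ` B. (y, b) \<notin> edges R" by blast
  from y(1) obtain x where "x \<in> verts G" "y = f x" using im by blast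
  with y show "\<exists>x\<in>verts G. x \<notin> A \<union> B \<and> (\<forall>a\<in>A. (x, a) \<in> edges G) \<and> (\<forall>b\<in>B. (x, b) \<notin> edges G)"
    using f(2) A(2) B(2) by (intro bexI[of _ x] conjI) blast+
qed

lemma extension_axiom_partition:
  assumes "extension_axiom G" "X0 \<union> X1 = verts G" and disj: "X0 \<inter> X1 = {}"
  shows "extension_axiom (induced G X0) \<or> extension_axiom (induced G X1)"
proof (rule ccontr)
  assume neg: "\<not> ?thesis"
  \<comment> \<open>On \<open>X\<close> the induced edges agree with those of \<open>G\<close>, so a
    violation can be stated with \<open>edges G\<close>; this lets the two violations be
    combined.\<close>
  have fail: "\<exists>A B. finite A \<and> finite B \<and> A \<subseteq> X \<and> B \<subseteq> X \<and> A \<inter> B = {} \<and>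
      \<not> (\<exists>x\<in>X. x \<notin> A \<union> B \<and> (\<forall>a\<in>A. (x, a) \<in> edges G) \<and> (\<forall>b\<in>B. (x, b) \<notin> edges G))"
    if not_ext: "\<not> extension_axiom (induced G X)" for X
  proof (rule ccontr)
    assume *: "\<not> ?thesis"
    have "extension_axiom (induced G X)"
      unfolding extension_axiom_def
    proof (intro allI impI, elim conjE)
      fix A B assume AB: "finite A" "finite B" "A \<subseteq> verts (induced G X)"
        "B \<subseteq> verts (induced G X)" "A \<inter> B = {}"
      then have "\<exists>x\<in>X. x \<notin> A \<union> B \<and> (\<forall>a\<in>A. (x, a) \<in> edges G) \<and> (\<forall>b\<in>B. (x, b) \<notin> edges G)"
        using * unfolding induced_def ngraph.simps by blast
      then show "\<exists>x\<in>verts (induced G X). x \<notin> A \<union> B \<and>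
          (\<forall>a\<in>A. (x, a) \<in> edges (induced G X)) \<and> (\<forall>b\<in>B. (x, b) \<notin> edges (induced G X))"
        using AB unfolding induced_def ngraph.simps by blast
    qed
    with not_ext show False ..
  qed
  obtain A0 B0 where 0: "finite A0" "finite B0" "A0 \<subseteq> X0" "B0 \<subseteq> X0" "A0 \<inter> B0 = {}"
    "\<not> (\<exists>x\<in>X0. x \<notin> A0 \<union> B0 \<and> (\<forall>a\<in>A0. (x, a) \<in> edges G) \<and> (\<forall>b\<in>B0. (x, b) \<notin> edges G))"
    using fail neg by meson
  obtain A1 B1 where 1: "finite A1" "finite B1" "A1 \<subseteq> X1" "B1 \<subseteq> X1" "A1 \<inter> B1 = {}"
    "\<not> (\<exists>x\<in>X1. x \<notin> A1 \<union> B1 \<and> (\<forall>a\<in>A1. (x, a) \<in> edges G) \<and> (\<forall>b\<in>B1. (x, b) \<notin> edges G))"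
    using fail neg by meson
  \<comment> \<open>The united sets are disjoint because the parts are. A vertex for them lies in
    one of the parts and contradicts the violation there.\<close>
  have "\<exists>x\<in>verts G. x \<notin> (A0 \<union> A1) \<union> (B0 \<union> B1) \<and> (\<forall>a\<in>A0 \<union> A1. (x, a) \<in> edges G) \<and>
      (\<forall>b\<in>B0 \<union> B1. (x, b) \<notin> edges G)"
    using assms 0(1-5) 1(1-5) disj by (intro extension_axiomD) blast+
  with 0(6) 1(6) assms(2) show False by blast
qed

lemma computable_graph_induced:
  assumes "computable_graph G" "computable_set X" shows "computable_graph (induced G X)"
proof -
  have "is_graph (induced G X)"
    using assms(1) unfolding computable_graph_def is_graph_def induced_def irrefl_def sym_def by auto
  moreover have "computable_rel (edges G \<inter> X \<times> X)"
    using assms unfolding computable_graph_def Int_iff mem_Times_iff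
    by (intro computable_relI)
      (auto intro!: decidable_conj computable_relD computable_setD computable_fun_nth)
  ultimately show ?thesis
    using assms(2) by (simp add: computable_graph_def induced_def)
qed

theorem theorem3p1:
  fixes G :: ngraph
  assumes "computable_graph G"
    and "isomorphic G complete_omega \<or> isomorphic G edgeless_omega \<or>
         (\<exists>R. random_graph R \<and> isomorphic G R)"
  shows "\<forall>X0 X1. computable_partition (verts G) X0 X1 \<longrightarrow>
           computably_isomorphic (induced G X0) G \<or> computably_isomorphic (induced G X1) G"
proof (intro allI impI)
  fix X0 X1 assume part: "computable_partition (verts G) X0 X1"
  then have union: "X0 \<union> X1 = verts G" and disj: "X0 \<inter> X1 = {}"
    and comp: "computable_set X0" "computable_set X1"
    unfolding computable_partition_def by auto
  have graphs: "computable_graph (induced G X)" if "X \<in> {X0, X1}" for X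
    using computable_graph_induced[OF assms(1)] comp that by auto
  have "\<exists>X\<in>{X0, X1}. extendable (induced G X) G \<and> extendable G (induced G X) \<and> X \<noteq> {}"
  proof (cases "\<exists>R. random_graph R \<and> isomorphic G R")
    case True
    then have ext: "extension_axiom G"
      unfolding random_graph_def using extension_axiom_isomorphic by blast
    then obtain X where X: "X \<in> {X0, X1}" "extension_axiom (induced G X)"
      using extension_axiom_partition[OF _ union disj] by blast
    \<comment> \<open>The extension axiom for two empty sets already provides a vertex.\<close>
    then have "X \<noteq> {}" unfolding extension_axiom_def induced_def by force
    then show ?thesis
      using X ext graphs assms(1) extendable_extension_axiom unfolding computable_graph_def by blast
  next
    case False
    \<comment> \<open>The Boolean \<open>b\<close> merges the complete and the edgeless
      case.\<close>
    then have "\<exists>b H. (H = complete_omega \<and> b \<or> H = edgeless_omega \<and> \<not> b) \<and> isomorphic G H"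
      using assms(2) by blast
    then obtain b H f where H: "H = complete_omega \<and> b \<or> H = edgeless_omega \<and> \<not> b"
      and iso: "graph_iso f G H" unfolding isomorphic_def by blast
    have f: "bij_betw f (verts G) (UNIV :: nat set)"
      using H iso by (auto simp: graph_iso_def complete_omega_def edgeless_omega_def)
    have b: "(x, y) \<in> edges G \<longleftrightarrow> f x \<noteq> f y \<and> b" if "x \<in> verts G" "y \<in> verts G" for x y
      using H iso that by (auto simp: graph_iso_def complete_omega_def edgeless_omega_def)
    have inf: "infinite (verts G)" using bij_betw_finite[OF f] by simp
    have edges: "(x, y) \<in> edges G \<longleftrightarrow> x \<noteq> y \<and> b" if "x \<in> verts G" "y \<in> verts G" for x y
      using b that f by (auto simp: bij_betw_def inj_on_eq_iff)
    obtain X where X: "X \<in> {X0, X1}" "infinite X"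
      using inf union by (metis finite_UnI insertCI)
    have "(x, y) \<in> edges (induced G X) \<longleftrightarrow> x \<noteq> y \<and> b"
      if "x \<in> verts (induced G X)" "y \<in> verts (induced G X)" for x y
      using that edges union X(1) by (auto simp: induced_def)
    moreover have "infinite (verts (induced G X))" using X(2) by (simp add: induced_def)
    ultimately show ?thesis
      using extendable_uniform edges inf X by (metis finite.emptyI)
  qed
  then obtain X where X: "X \<in> {X0, X1}" "extendable (induced G X) G" "extendable G (induced G X)"
      "X \<noteq> {}" by blast
  then have "computably_isomorphic (induced G X) G"
    using graphs assms(1) by (intro computably_isomorphicI) (auto simp: induced_def)
  with X(1) show "computably_isomorphic (induced G X0) G \<or> computably_isomorphic (induced G X1) G"
    by blast
qed

end
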